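(* Let $\mathsf{K}$ be any class of $\mathcal{L}$-lattices. Then there is a one-to-one correspondence between the members of $\mathsf{mK}$ and the ordered pairs $\langle\mathbf{A},\mathbf{A}_0\rangle$ such that $\mathbf{A}\in\mathsf{K}$ and $\mathbf{A}_0$ is a relatively complete subalgebra of $\mathbf{A}$, implemented by the mutually inverse maps $\langle\mathbf{A},\Box,\Diamond\rangle\mapsto\langle\mathbf{A},\Box\mathbf{A}\rangle$ and $\langle\mathbf{A},\mathbf{A}_0\rangle\mapsto\langle\mathbf{A},\Box_0,\Diamond_0\rangle$, where $\Box\mathbf{A}$ is the subalgebra of $\mathbf{A}$ with universe $\{\Box a\mid a\in A\}$, and $\Box_0a:=\max\{b\in A_0\mid b\le a\}$, $\Diamond_0 a:=\min\{b\in A_0\mid a\le b\}$.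
   Context: $\mathcal{L}$ is a lattice-oriented signature: an algebraic signature (with $\mathcal{L}_n$ its $n$-ary operation symbols) containing distinct binary symbols $\land,\lor$. An $\mathcal{L}$-lattice is an algebra of signature $\mathcal{L}$ whose $\{\land,\lor\}$-reduct is a lattice (order $a\le b$ iff $a\land b=a$). A subalgebra $\mathbf{A}_0$ of an $\mathcal{L}$-lattice $\mathbf{A}$ is relatively complete if for every $a\in A$ the set $\{b\in A_0\mid b\le a\}$ has a maximum and $\{b\in A_0\mid a\le b\}$ has a minimum. An m-lattice is an algebra $\langle L,\land,\lor,\Box,\Diamond\rangle$ with lattice reduct satisfying $\Box x\land x\approx \Box x$, $\Box(x\land y)\approx\Box x\land\Box y$, $\Box\Diamond x\approx\Diamond x$, $\Diamond x\lor x\approx\Diamond x$, $\Diamond(x\lor y)\approx\Diamond x\lor\Diamond y$, $\Diamond\Box x\approx\Box x$. An m-$\mathcal{L}$-lattice is $\langle\mathbf{A},\Box,\Diamond\rangle$ with $\mathbf{A}$ an $\mathcal{L}$-lattice, $\langle A,\land,\lor,\Box,\Diamond\rangle$ an m-lattice, and $\Box(\star(\Box x_1,\dots,\Box x_n))\approx\star(\Box x_1,\dots,\Box x_n)$ for every $n$ and $\star\in\mathcal{L}_n$. For a class $\mathsf{K}$ of $\mathcal{L}$-lattices, $\mathsf{mK}$ denotes the class of m-$\mathcal{L}$-lattices whose $\mathcal{L}$-lattice reduct belongs to $\mathsf{K}$. *)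

theory Defs
  imports Main "HOL-Library.FuncSet"
begin

text \<open>
  The operation symbols of a signature are the elements of the type \<open>'f\<close>; the set
  $\mathcal{L}_n$ is \<open>{f. arity L f = n}\<close>.
\<close>

record 'f signature =
  arity :: "'f \<Rightarrow> nat"
  meet_sym :: 'f
  join_sym :: 'f

definition lattice_oriented :: "'f signature \<Rightarrow> bool" where
  "lattice_oriented L \<longleftrightarrow>
     arity L (meet_sym L) = 2 \<and> arity L (join_sym L) = 2 \<and> meet_sym L \<noteq> join_sym L"

record ('f, 'a) alg =
  univ :: "'a set"
  interp :: "'f \<Rightarrow> 'a list \<Rightarrow> 'a"

definition args :: "'f signature \<Rightarrow> 'a set \<Rightarrow> 'f \<Rightarrow> 'a list set" where
  "args L U f = {xs. length xs = arity L f \<and> set xs \<subseteq> U}"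

text \<open>
  Operations are extensional (\<open>undefined\<close> off their domain), so that equality of records is
  equality of algebras. The same convention is used below for $\Box$ and $\Diamond$.
\<close>

definition algebra_of :: "'f signature \<Rightarrow> ('f, 'a) alg \<Rightarrow> bool" where
  "algebra_of L A \<longleftrightarrow>
     univ A \<noteq> {} \<and> (\<forall>f. interp A f \<in> args L (univ A) f \<rightarrow>\<^sub>E univ A)"

definition meet :: "'f signature \<Rightarrow> ('f, 'a) alg \<Rightarrow> 'a \<Rightarrow> 'a \<Rightarrow> 'a" where
  "meet L A x y = interp A (meet_sym L) [x, y]"

definition join :: "'f signature \<Rightarrow> ('f, 'a) alg \<Rightarrow> 'a \<Rightarrow> 'a \<Rightarrow> 'a" where
  "join L A x y = interp A (join_sym L) [x, y]"

definition lattice_on :: "'a set \<Rightarrow> ('a \<Rightarrow> 'a \<Rightarrow> 'a) \<Rightarrow> ('a \<Rightarrow> 'a \<Rightarrow> 'a) \<Rightarrow> bool" where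
  "lattice_on U m j \<longleftrightarrow>
     U \<noteq> {} \<and>
     (\<forall>x\<in>U. \<forall>y\<in>U. m x y \<in> U \<and> j x y \<in> U) \<and>
     (\<forall>x\<in>U. \<forall>y\<in>U. m x y = m y x \<and> j x y = j y x) \<and>
     (\<forall>x\<in>U. \<forall>y\<in>U. \<forall>z\<in>U. m (m x y) z = m x (m y z) \<and> j (j x y) z = j x (j y z)) \<and>
     (\<forall>x\<in>U. \<forall>y\<in>U. m x (j x y) = x \<and> j x (m x y) = x)"

definition L_lattice :: "'f signature \<Rightarrow> ('f, 'a) alg \<Rightarrow> bool" where
  "L_lattice L A \<longleftrightarrow> algebra_of L A \<and> lattice_on (univ A) (meet L A) (join L A)"

definition leq :: "'f signature \<Rightarrow> ('f, 'a) alg \<Rightarrow> 'a \<Rightarrow> 'a \<Rightarrow> bool" where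
  "leq L A a b \<longleftrightarrow> meet L A a b = a"

definition is_max :: "'f signature \<Rightarrow> ('f, 'a) alg \<Rightarrow> 'a set \<Rightarrow> 'a \<Rightarrow> bool" where
  "is_max L A S m \<longleftrightarrow> m \<in> S \<and> (\<forall>b\<in>S. leq L A b m)"

definition is_min :: "'f signature \<Rightarrow> ('f, 'a) alg \<Rightarrow> 'a set \<Rightarrow> 'a \<Rightarrow> bool" where
  "is_min L A S m \<longleftrightarrow> m \<in> S \<and> (\<forall>b\<in>S. leq L A m b)"

definition max_of :: "'f signature \<Rightarrow> ('f, 'a) alg \<Rightarrow> 'a set \<Rightarrow> 'a" where
  "max_of L A S = (THE m. is_max L A S m)"

definition min_of :: "'f signature \<Rightarrow> ('f, 'a) alg \<Rightarrow> 'a set \<Rightarrow> 'a" where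
  "min_of L A S = (THE m. is_min L A S m)"

definition subalgebra :: "'f signature \<Rightarrow> ('f, 'a) alg \<Rightarrow> ('f, 'a) alg \<Rightarrow> bool" where
  "subalgebra L A0 A \<longleftrightarrow>
     algebra_of L A0 \<and> univ A0 \<subseteq> univ A \<and>
     (\<forall>f. \<forall>xs \<in> args L (univ A0) f. interp A0 f xs = interp A f xs)"

definition relatively_complete :: "'f signature \<Rightarrow> ('f, 'a) alg \<Rightarrow> ('f, 'a) alg \<Rightarrow> bool" where
  "relatively_complete L A0 A \<longleftrightarrow>
     subalgebra L A0 A \<and>
     (\<forall>a \<in> univ A.
        (\<exists>m. is_max L A {b \<in> univ A0. leq L A b a} m) \<and>
        (\<exists>m. is_min L A {b \<in> univ A0. leq L A a b} m))"

definition m_lattice_on ::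
  "'a set \<Rightarrow> ('a \<Rightarrow> 'a \<Rightarrow> 'a) \<Rightarrow> ('a \<Rightarrow> 'a \<Rightarrow> 'a) \<Rightarrow> ('a \<Rightarrow> 'a) \<Rightarrow> ('a \<Rightarrow> 'a) \<Rightarrow> bool" where
  "m_lattice_on U m j box dia \<longleftrightarrow>
     lattice_on U m j \<and> box \<in> U \<rightarrow>\<^sub>E U \<and> dia \<in> U \<rightarrow>\<^sub>E U \<and>
     (\<forall>x\<in>U. m (box x) x = box x) \<and>
     (\<forall>x\<in>U. \<forall>y\<in>U. box (m x y) = m (box x) (box y)) \<and>
     (\<forall>x\<in>U. box (dia x) = dia x) \<and>
     (\<forall>x\<in>U. j (dia x) x = dia x) \<and>
     (\<forall>x\<in>U. \<forall>y\<in>U. dia (j x y) = j (dia x) (dia y)) \<and>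
     (\<forall>x\<in>U. dia (box x) = box x)"

type_synonym ('f, 'a) malg = "('f, 'a) alg \<times> ('a \<Rightarrow> 'a) \<times> ('a \<Rightarrow> 'a)"

definition m_L_lattice :: "'f signature \<Rightarrow> ('f, 'a) malg \<Rightarrow> bool" where
  "m_L_lattice L = (\<lambda>(A, box, dia).
     L_lattice L A \<and> m_lattice_on (univ A) (meet L A) (join L A) box dia \<and>
     (\<forall>f. \<forall>xs \<in> args L (univ A) f.
        box (interp A f (map box xs)) = interp A f (map box xs)))"

definition mK :: "'f signature \<Rightarrow> ('f, 'a) alg set \<Rightarrow> ('f, 'a) malg set" where
  "mK L K = {(A, box, dia). m_L_lattice L (A, box, dia) \<and> A \<in> K}"

definition rc_pairs ::
  "'f signature \<Rightarrow> ('f, 'a) alg set \<Rightarrow> (('f, 'a) alg \<times> ('f, 'a) alg) set" where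
  "rc_pairs L K = {(A, A0). A \<in> K \<and> relatively_complete L A0 A}"

text \<open>A subalgebra only when \<open>B\<close> is nonempty and closed under the operations of \<open>A\<close>.\<close>

definition restrict_alg :: "'f signature \<Rightarrow> ('f, 'a) alg \<Rightarrow> 'a set \<Rightarrow> ('f, 'a) alg" where
  "restrict_alg L A B = \<lparr>univ = B, interp = (\<lambda>f. restrict (interp A f) (args L B f))\<rparr>"

definition box_alg :: "'f signature \<Rightarrow> ('f, 'a) alg \<Rightarrow> ('a \<Rightarrow> 'a) \<Rightarrow> ('f, 'a) alg" where
  "box_alg L A box = restrict_alg L A {box a | a. a \<in> univ A}"

definition box0 :: "'f signature \<Rightarrow> ('f, 'a) alg \<Rightarrow> ('f, 'a) alg \<Rightarrow> 'a \<Rightarrow> 'a" where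
  "box0 L A A0 = (\<lambda>a \<in> univ A. max_of L A {b \<in> univ A0. leq L A b a})"

definition dia0 :: "'f signature \<Rightarrow> ('f, 'a) alg \<Rightarrow> ('f, 'a) alg \<Rightarrow> 'a \<Rightarrow> 'a" where
  "dia0 L A A0 = (\<lambda>a \<in> univ A. min_of L A {b \<in> univ A0. leq L A a b})"

definition to_pair :: "'f signature \<Rightarrow> ('f, 'a) malg \<Rightarrow> ('f, 'a) alg \<times> ('f, 'a) alg" where
  "to_pair L = (\<lambda>(A, box, dia). (A, box_alg L A box))"

definition of_pair :: "'f signature \<Rightarrow> ('f, 'a) alg \<times> ('f, 'a) alg \<Rightarrow> ('f, 'a) malg" where
  "of_pair L = (\<lambda>(A, A0). (A, box0 L A A0, dia0 L A A0))"

end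

theory Submission
  imports Defs
begin

text \<open>
  In an m-lattice, \<open>\<box>\<close> and \<open>\<diamond>\<close> are idempotent and monotone and have the same fixed points, which
  are the elements of \<open>\<box>A\<close>. Hence \<open>\<box>a\<close> and \<open>\<diamond>a\<close> are the best approximations of \<open>a\<close> by \<open>\<box>A\<close> from
  below and above, so \<open>\<box>A\<close> is relatively complete and determines both operators. Conversely, the
  approximation operators of a relatively complete subalgebra fix exactly its elements, and the
  equations of m-lattices follow from the extremal property of the approximations.
\<close>

section \<open>The order of the lattice reduct\<close>

context
  fixes L :: "'f signature" and A :: "('f, 'a) alg"
  assumes L_lattice: "L_lattice L A"
begin

lemma meet_closed: "x \<in> univ A \<Longrightarrow> y \<in> univ A \<Longrightarrow> meet L A x y \<in> univ A"
  and join_closed: "x \<in> univ A \<Longrightarrow> y \<in> univ A \<Longrightarrow> join L A x y \<in> univ A"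
  and meet_comm: "x \<in> univ A \<Longrightarrow> y \<in> univ A \<Longrightarrow> meet L A x y = meet L A y x"
  and join_comm: "x \<in> univ A \<Longrightarrow> y \<in> univ A \<Longrightarrow> join L A x y = join L A y x"
  and meet_assoc: "x \<in> univ A \<Longrightarrow> y \<in> univ A \<Longrightarrow> z \<in> univ A \<Longrightarrow>
    meet L A (meet L A x y) z = meet L A x (meet L A y z)"
  and join_assoc: "x \<in> univ A \<Longrightarrow> y \<in> univ A \<Longrightarrow> z \<in> univ A \<Longrightarrow>
    join L A (join L A x y) z = join L A x (join L A y z)"
  and meet_absorb: "x \<in> univ A \<Longrightarrow> y \<in> univ A \<Longrightarrow> meet L A x (join L A x y) = x"
  and join_absorb: "x \<in> univ A \<Longrightarrow> y \<in> univ A \<Longrightarrow> join L A x (meet L A x y) = x"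
  using L_lattice unfolding L_lattice_def lattice_on_def by meson+

text \<open>Absorption alone gives idempotence: by the two laws
  \<open>meet L A x (join L A x (meet L A x x))\<close> equals both \<open>x\<close> and
  \<open>meet L A x x\<close>.\<close>

lemma leq_refl: "x \<in> univ A \<Longrightarrow> leq L A x x"
  unfolding leq_def by (metis meet_absorb join_absorb meet_closed)

lemma leq_antisym:
  "x \<in> univ A \<Longrightarrow> y \<in> univ A \<Longrightarrow> leq L A x y \<Longrightarrow> leq L A y x \<Longrightarrow> x = y"
  unfolding leq_def by (metis meet_comm)

lemma leq_trans:
  "x \<in> univ A \<Longrightarrow> y \<in> univ A \<Longrightarrow> z \<in> univ A \<Longrightarrow> leq L A x y \<Longrightarrow> leq L A y z \<Longrightarrow> leq L A x z"
  unfolding leq_def by (metis meet_assoc)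

lemma leq_iff_join:
  "x \<in> univ A \<Longrightarrow> y \<in> univ A \<Longrightarrow> leq L A x y \<longleftrightarrow> join L A x y = y"
  unfolding leq_def by (metis meet_comm join_comm meet_absorb join_absorb)

lemma meet_leq1: "x \<in> univ A \<Longrightarrow> y \<in> univ A \<Longrightarrow> leq L A (meet L A x y) x"
  using leq_iff_join join_absorb join_comm meet_closed by metis

lemma meet_leq2: "x \<in> univ A \<Longrightarrow> y \<in> univ A \<Longrightarrow> leq L A (meet L A x y) y"
  using meet_leq1 meet_comm by metis

lemma leq_meet:
  "x \<in> univ A \<Longrightarrow> y \<in> univ A \<Longrightarrow> z \<in> univ A \<Longrightarrow> leq L A z x \<Longrightarrow> leq L A z y \<Longrightarrow>
    leq L A z (meet L A x y)"
  unfolding leq_def by (metis meet_assoc)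

lemma join_geq1: "x \<in> univ A \<Longrightarrow> y \<in> univ A \<Longrightarrow> leq L A x (join L A x y)"
  unfolding leq_def by (rule meet_absorb)

lemma join_geq2: "x \<in> univ A \<Longrightarrow> y \<in> univ A \<Longrightarrow> leq L A y (join L A x y)"
  using join_geq1 join_comm by metis

lemma join_leq:
  "x \<in> univ A \<Longrightarrow> y \<in> univ A \<Longrightarrow> z \<in> univ A \<Longrightarrow> leq L A x z \<Longrightarrow> leq L A y z \<Longrightarrow>
    leq L A (join L A x y) z"
  using leq_iff_join join_assoc join_closed by metis

text \<open>Antisymmetry is available only on the carrier, hence the inclusion. It makes the maximum
  unique, so the \<open>THE\<close> in \<open>max_of\<close> returns \<open>m\<close>.\<close>

lemma max_of_eq:
  assumes "S \<subseteq> univ A" "is_max L A S m"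
  shows "max_of L A S = m"
  unfolding max_of_def
proof (rule the_equality)
  fix m' assume "is_max L A S m'"
  then show "m' = m"
    using assms leq_antisym unfolding is_max_def by blast
qed (fact assms(2))

lemma min_of_eq:
  assumes "S \<subseteq> univ A" "is_min L A S m"
  shows "min_of L A S = m"
  unfolding min_of_def
proof (rule the_equality)
  fix m' assume "is_min L A S m'"
  then show "m' = m"
    using assms leq_antisym unfolding is_min_def by blast
qed (fact assms(2))

section \<open>m-lattices and the subalgebra of box elements\<close>

context
  fixes box dia :: "'a \<Rightarrow> 'a"
  assumes m_L_lattice: "m_L_lattice L (A, box, dia)"
begin

lemma box_extensional: "box \<in> univ A \<rightarrow>\<^sub>E univ A"
  and dia_extensional: "dia \<in> univ A \<rightarrow>\<^sub>E univ A"
  and box_leq: "x \<in> univ A \<Longrightarrow> leq L A (box x) x"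
  and box_meet: "x \<in> univ A \<Longrightarrow> y \<in> univ A \<Longrightarrow> box (meet L A x y) = meet L A (box x) (box y)"
  and box_dia: "x \<in> univ A \<Longrightarrow> box (dia x) = dia x"
  and join_dia: "x \<in> univ A \<Longrightarrow> join L A (dia x) x = dia x"
  and dia_join: "x \<in> univ A \<Longrightarrow> y \<in> univ A \<Longrightarrow> dia (join L A x y) = join L A (dia x) (dia y)"
  and dia_box: "x \<in> univ A \<Longrightarrow> dia (box x) = box x"
  and box_interp: "xs \<in> args L (univ A) f \<Longrightarrow>
    box (interp A f (map box xs)) = interp A f (map box xs)"
  using m_L_lattice unfolding m_L_lattice_def m_lattice_on_def leq_def by auto

lemma box_closed: "x \<in> univ A \<Longrightarrow> box x \<in> univ A"
  using box_extensional by blast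

lemma dia_closed: "x \<in> univ A \<Longrightarrow> dia x \<in> univ A"
  using dia_extensional by blast

lemma leq_dia: "x \<in> univ A \<Longrightarrow> leq L A x (dia x)"
  using leq_iff_join join_dia join_comm dia_closed by metis

text \<open>Since \<open>dia\<close> fixes \<open>box x\<close>, the element \<open>box x\<close> is
  a value of \<open>dia\<close>, and \<open>box\<close> fixes every value of
  \<open>dia\<close>.\<close>

lemma box_idem: "x \<in> univ A \<Longrightarrow> box (box x) = box x"
  by (metis box_dia dia_box box_closed)

lemma box_mono:
  "x \<in> univ A \<Longrightarrow> y \<in> univ A \<Longrightarrow> leq L A x y \<Longrightarrow> leq L A (box x) (box y)"
  unfolding leq_def by (metis box_meet)

lemma dia_mono:
  "x \<in> univ A \<Longrightarrow> y \<in> univ A \<Longrightarrow> leq L A x y \<Longrightarrow> leq L A (dia x) (dia y)"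
  using leq_iff_join dia_join dia_closed by metis

text \<open>The image of an idempotent map is its set of fixed points.\<close>

lemma univ_box_alg: "univ (box_alg L A box) = {x \<in> univ A. box x = x}"
  unfolding box_alg_def restrict_alg_def using box_closed box_idem by force

text \<open>If \<open>box x = x\<close>, then \<open>dia x = dia (box x) = box x = x\<close>; the
  converse is symmetric. This form is what the minimality of \<open>dia a\<close> needs.\<close>

lemma univ_box_alg_dia: "univ (box_alg L A box) = {x \<in> univ A. dia x = x}"
  unfolding univ_box_alg using box_dia dia_box by metis

text \<open>For a fixed point \<open>b\<close> below \<open>a\<close>, monotonicity puts
  \<open>b = box b\<close> below \<open>box a\<close>.\<close>

lemma is_max_box:
  assumes "a \<in> univ A"
  shows "is_max L A {b \<in> univ (box_alg L A box). leq L A b a} (box a)"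
  unfolding is_max_def univ_box_alg
  using assms box_closed box_idem box_leq box_mono by fastforce

lemma is_min_dia:
  assumes "a \<in> univ A"
  shows "is_min L A {b \<in> univ (box_alg L A box). leq L A a b} (dia a)"
  unfolding is_min_def
proof (intro conjI ballI)
  show "dia a \<in> {b \<in> univ (box_alg L A box). leq L A a b}"
    using assms by (simp add: univ_box_alg dia_closed box_dia leq_dia)
next
  fix b assume "b \<in> {b \<in> univ (box_alg L A box). leq L A a b}"
  \<comment> \<open>Here \<open>b\<close> is also fixed by \<open>dia\<close>, so monotonicity puts
    \<open>dia a\<close> below \<open>dia b = b\<close>.\<close>
  then show "leq L A (dia a) b"
    using assms dia_mono[of a b] by (simp add: univ_box_alg_dia)
qed

lemma subalgebra_box_alg: "subalgebra L (box_alg L A box) A"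
proof -
  let ?B = "{x \<in> univ A. box x = x}"
  have eq: "box_alg L A box = restrict_alg L A ?B"
    using univ_box_alg unfolding box_alg_def restrict_alg_def by simp
  have "?B \<noteq> {}"
    using L_lattice box_closed box_idem unfolding L_lattice_def algebra_of_def by blast
  moreover have "interp A f xs \<in> ?B" if "xs \<in> args L ?B f" for f xs
  proof -
    \<comment> \<open>Mapping \<open>box\<close> over fixed points changes nothing, so
      \<open>box_interp\<close> says directly that the result is fixed as well.\<close>
    have xs: "xs \<in> args L (univ A) f" and "map box xs = xs"
      using that by (auto simp: args_def subset_iff intro: map_idI)
    then show ?thesis
      using box_interp[OF xs] L_lattice unfolding L_lattice_def algebra_of_def by auto
  qed
  ultimately show ?thesis
    unfolding eq subalgebra_def algebra_of_def restrict_alg_def by auto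
qed

lemma relatively_complete_box_alg: "relatively_complete L (box_alg L A box) A"
  unfolding relatively_complete_def
  by (intro conjI ballI exI) (rule subalgebra_box_alg is_max_box is_min_dia, assumption?)+

lemma box0_box_alg: "box0 L A (box_alg L A box) = box"
proof
  fix a
  show "box0 L A (box_alg L A box) a = box a"
  proof (cases "a \<in> univ A")
    case True
    have "max_of L A {b \<in> univ (box_alg L A box). leq L A b a} = box a"
      by (rule max_of_eq[OF _ is_max_box[OF True]]) (auto simp: univ_box_alg)
    with True show ?thesis
      by (simp add: box0_def)
  next
    case False
    \<comment> \<open>Off the carrier both sides are \<open>undefined\<close>: one by restriction,
      the other by extensionality of \<open>box\<close>.\<close>
    then show ?thesis
      using PiE_arb[OF box_extensional False] by (simp add: box0_def)
  qed
qed

lemma dia0_box_alg: "dia0 L A (box_alg L A box) = dia"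
proof
  fix a
  show "dia0 L A (box_alg L A box) a = dia a"
  proof (cases "a \<in> univ A")
    case True
    have "min_of L A {b \<in> univ (box_alg L A box). leq L A a b} = dia a"
      by (rule min_of_eq[OF _ is_min_dia[OF True]]) (auto simp: univ_box_alg)
    with True show ?thesis
      by (simp add: dia0_def)
  next
    case False
    then show ?thesis
      using PiE_arb[OF dia_extensional False] by (simp add: dia0_def)
  qed
qed

end

section \<open>Approximation operators of a relatively complete subalgebra\<close>

context
  fixes A0 :: "('f, 'a) alg"
  assumes rel_complete: "relatively_complete L A0 A"
begin

lemma sub_univ: "x \<in> univ A0 \<Longrightarrow> x \<in> univ A"
  using rel_complete unfolding relatively_complete_def subalgebra_def by blast

lemma sub_interp: "xs \<in> args L (univ A0) f \<Longrightarrow> interp A f xs \<in> univ A0"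
  using rel_complete unfolding relatively_complete_def subalgebra_def algebra_of_def
  by (metis PiE_mem)

text \<open>Relative completeness supplies a maximum, and uniqueness identifies it with the value of
  the definite description.\<close>

lemma is_max_box0:
  assumes "a \<in> univ A"
  shows "is_max L A {b \<in> univ A0. leq L A b a} (box0 L A A0 a)"
proof -
  obtain m where m: "is_max L A {b \<in> univ A0. leq L A b a} m"
    using rel_complete assms unfolding relatively_complete_def by blast
  moreover have "box0 L A A0 a = m"
    using max_of_eq[OF _ m] assms sub_univ by (auto simp: box0_def)
  ultimately show ?thesis by simp
qed

lemma is_min_dia0:
  assumes "a \<in> univ A"
  shows "is_min L A {b \<in> univ A0. leq L A a b} (dia0 L A A0 a)"
proof -
  obtain m where m: "is_min L A {b \<in> univ A0. leq L A a b} m"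
    using rel_complete assms unfolding relatively_complete_def by blast
  moreover have "dia0 L A A0 a = m"
    using min_of_eq[OF _ m] assms sub_univ by (auto simp: dia0_def)
  ultimately show ?thesis by simp
qed

lemma box0_in: "a \<in> univ A \<Longrightarrow> box0 L A A0 a \<in> univ A0"
  and box0_leq: "a \<in> univ A \<Longrightarrow> leq L A (box0 L A A0 a) a"
  and leq_box0: "a \<in> univ A \<Longrightarrow> b \<in> univ A0 \<Longrightarrow> leq L A b a \<Longrightarrow> leq L A b (box0 L A A0 a)"
  using is_max_box0 unfolding is_max_def by blast+

lemma dia0_in: "a \<in> univ A \<Longrightarrow> dia0 L A A0 a \<in> univ A0"
  and leq_dia0: "a \<in> univ A \<Longrightarrow> leq L A a (dia0 L A A0 a)"
  and dia0_leq: "a \<in> univ A \<Longrightarrow> b \<in> univ A0 \<Longrightarrow> leq L A a b \<Longrightarrow> leq L A (dia0 L A A0 a) b"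
  using is_min_dia0 unfolding is_min_def by blast+

text \<open>By reflexivity \<open>b\<close> is itself among the elements of \<open>A0\<close> below
  \<open>b\<close>, so it is their maximum.\<close>

lemma box0_fix: "b \<in> univ A0 \<Longrightarrow> box0 L A A0 b = b"
  by (meson box0_in box0_leq leq_box0 leq_antisym leq_refl sub_univ)

lemma dia0_fix: "b \<in> univ A0 \<Longrightarrow> dia0 L A A0 b = b"
  by (meson dia0_in leq_dia0 dia0_leq leq_antisym leq_refl sub_univ)

text \<open>Every value of \<open>box0\<close> lies in \<open>A0\<close>, and every element of
  \<open>A0\<close> is its own value, so the universes agree.\<close>

lemma box_alg_box0: "box_alg L A (box0 L A A0) = A0"
proof -
  have "{box0 L A A0 a | a. a \<in> univ A} = univ A0"
    using box0_in box0_fix sub_univ by force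
  \<comment> \<open>On arguments from \<open>A0\<close> this is the subalgebra condition; elsewhere
    both sides are \<open>undefined\<close>, so the records are equal and not merely
    isomorphic.\<close>
  moreover have "restrict (interp A f) (args L (univ A0) f) = interp A0 f" for f
  proof
    fix xs
    have sub: "subalgebra L A0 A"
      using rel_complete unfolding relatively_complete_def by blast
    then have ext: "interp A0 f \<in> args L (univ A0) f \<rightarrow>\<^sub>E univ A0"
      unfolding subalgebra_def algebra_of_def by blast
    show "restrict (interp A f) (args L (univ A0) f) xs = interp A0 f xs"
      using sub PiE_arb[OF ext, of xs] unfolding subalgebra_def by auto
  qed
  ultimately show ?thesis
    unfolding box_alg_def restrict_alg_def by simp
qed

text \<open>The meet of the approximations lies in \<open>A0\<close> and below both \<open>x\<close>
  and \<open>y\<close>, hence below the approximation of their meet. Conversely, that approximation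
  is an element of \<open>A0\<close> below \<open>x\<close> and below \<open>y\<close>.\<close>

lemma box0_meet:
  assumes "lattice_oriented L" "x \<in> univ A" "y \<in> univ A"
  shows "box0 L A A0 (meet L A x y) = meet L A (box0 L A A0 x) (box0 L A A0 y)"
    (is "?b (meet L A x y) = ?m")
proof (rule leq_antisym)
  have in_A: "?b x \<in> univ A" "?b y \<in> univ A" "?b (meet L A x y) \<in> univ A" "meet L A x y \<in> univ A"
    using assms box0_in sub_univ meet_closed by auto
  then show "?b (meet L A x y) \<in> univ A" "?m \<in> univ A"
    using meet_closed by auto
  \<comment> \<open>The meet symbol is binary, so a two-element list is an admissible argument and
    closure of \<open>A0\<close> applies.\<close>
  have "?m \<in> univ A0"
    unfolding meet_def using assms box0_in
    by (intro sub_interp) (simp add: args_def lattice_oriented_def)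
  moreover have "leq L A ?m (meet L A x y)"
  proof (rule leq_meet)
    show "leq L A ?m x"
      by (rule leq_trans[OF _ _ _ meet_leq1 box0_leq]) (use assms in_A meet_closed in simp_all)
    show "leq L A ?m y"
      by (rule leq_trans[OF _ _ _ meet_leq2 box0_leq]) (use assms in_A meet_closed in simp_all)
  qed (use assms in_A meet_closed in simp_all)
  ultimately show "leq L A ?m (?b (meet L A x y))"
    using leq_box0 in_A by blast
  have "leq L A (?b (meet L A x y)) x"
    by (rule leq_trans[OF _ _ _ box0_leq meet_leq1]) (use assms in_A in simp_all)
  moreover have "leq L A (?b (meet L A x y)) y"
    by (rule leq_trans[OF _ _ _ box0_leq meet_leq2]) (use assms in_A in simp_all)
  ultimately show "leq L A (?b (meet L A x y)) ?m"
    using assms in_A by (simp add: leq_box0 box0_in leq_meet)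
qed

lemma dia0_join:
  assumes "lattice_oriented L" "x \<in> univ A" "y \<in> univ A"
  shows "dia0 L A A0 (join L A x y) = join L A (dia0 L A A0 x) (dia0 L A A0 y)"
    (is "?d (join L A x y) = ?j")
proof (rule leq_antisym)
  have in_A: "?d x \<in> univ A" "?d y \<in> univ A" "?d (join L A x y) \<in> univ A" "join L A x y \<in> univ A"
    using assms dia0_in sub_univ join_closed by auto
  then show "?d (join L A x y) \<in> univ A" "?j \<in> univ A"
    using join_closed by auto
  have "?j \<in> univ A0"
    unfolding join_def using assms dia0_in
    by (intro sub_interp) (simp add: args_def lattice_oriented_def)
  moreover have "leq L A (join L A x y) ?j"
  proof (rule join_leq)
    show "leq L A x ?j"
      by (rule leq_trans[OF _ _ _ leq_dia0 join_geq1]) (use assms in_A join_closed in simp_all)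
    show "leq L A y ?j"
      by (rule leq_trans[OF _ _ _ leq_dia0 join_geq2]) (use assms in_A join_closed in simp_all)
  qed (use assms in_A join_closed in simp_all)
  ultimately show "leq L A (?d (join L A x y)) ?j"
    using dia0_leq in_A by blast
  have "leq L A x (?d (join L A x y))"
    by (rule leq_trans[OF _ _ _ join_geq1 leq_dia0]) (use assms in_A in simp_all)
  moreover have "leq L A y (?d (join L A x y))"
    by (rule leq_trans[OF _ _ _ join_geq2 leq_dia0]) (use assms in_A in simp_all)
  ultimately show "leq L A ?j (?d (join L A x y))"
    using assms in_A by (simp add: dia0_leq dia0_in join_leq)
qed

text \<open>The equations whose right side is fixed by an operator hold because that side lies in
  \<open>A0\<close>, where both operators are the identity. Closure of \<open>A0\<close> gives this
  for the operations of \<open>L\<close>.\<close>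

lemma m_L_lattice_box0_dia0:
  assumes "lattice_oriented L"
  shows "m_L_lattice L (A, box0 L A A0, dia0 L A A0)"
proof -
  have "join L A (dia0 L A A0 x) x = dia0 L A A0 x" if "x \<in> univ A" for x
    using that leq_dia0 leq_iff_join join_comm dia0_in sub_univ by metis
  moreover have "interp A f (map (box0 L A A0) xs) \<in> univ A0"
    if "xs \<in> args L (univ A) f" for f xs
    using that by (intro sub_interp) (auto simp: args_def box0_in)
  moreover have "box0 L A A0 \<in> univ A \<rightarrow>\<^sub>E univ A"
    using box0_in sub_univ by (auto simp: box0_def)
  moreover have "dia0 L A A0 \<in> univ A \<rightarrow>\<^sub>E univ A"
    using dia0_in sub_univ by (auto simp: dia0_def)
  ultimately show ?thesis
    using L_lattice box0_leq
    unfolding m_L_lattice_def m_lattice_on_def leq_def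
    by (simp add: L_lattice_def box0_meet[OF assms] dia0_join[OF assms] box0_fix dia0_fix box0_in dia0_in)
qed

end

end

theorem theorem3p5:
  fixes L :: "'f signature" and K :: "('f, 'a) alg set"
  assumes "lattice_oriented L"
    and "\<forall>A\<in>K. L_lattice L A"
  shows "bij_betw (to_pair L) (mK L K) (rc_pairs L K) \<and>
    bij_betw (of_pair L) (rc_pairs L K) (mK L K) \<and>
    (\<forall>M\<in>mK L K. of_pair L (to_pair L M) = M) \<and>
    (\<forall>P\<in>rc_pairs L K. to_pair L (of_pair L P) = P)"
proof -
  have to_of: "\<forall>M\<in>mK L K. of_pair L (to_pair L M) = M"
    using assms(2)
    by (auto simp: mK_def to_pair_def of_pair_def box0_box_alg dia0_box_alg)
  have of_to: "\<forall>P\<in>rc_pairs L K. to_pair L (of_pair L P) = P"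
    using assms(2) by (auto simp: rc_pairs_def to_pair_def of_pair_def box_alg_box0)
  have to: "to_pair L ` mK L K \<subseteq> rc_pairs L K"
    using assms(2) by (auto simp: mK_def rc_pairs_def to_pair_def relatively_complete_box_alg)
  have of_: "of_pair L ` rc_pairs L K \<subseteq> mK L K"
    using assms by (auto simp: mK_def rc_pairs_def of_pair_def m_L_lattice_box0_dia0)
  show ?thesis
    \<comment> \<open>Each map serves as the inverse witness for the other, so the same four facts
      are used twice with the roles exchanged.\<close>
    using bij_betw_byWitness[OF to_of of_to to of_] bij_betw_byWitness[OF of_to to_of of_ to]
      to_of of_to by blast
qed

end
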